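(* Let the 3-pan be the graph on vertices $e_1,e_2,e_3,e_4$ with edges $e_1e_2$, $e_2e_3$, $e_2e_4$, $e_3e_4$. Let $H$ be the $(e_2,2)$-ordering of the 3-pan. Then $R_<(H)\le 10$.
   Context: A $k$-ordering of a graph $H$ assigns distinct order-labels from $\{1,\ldots,|H|\}$ to $k$ of the vertices of $H$. For a vertex $v$ of $H$ and $1\le l\le |H|$, the $(v,l)$-ordering of $H$ is the 1-ordering in which $v$ receives order-label $l$ and no other vertex is labeled. An ordered 2-coloring on $n$ vertices is a red/blue coloring of the edges of the complete graph on vertex set $\{1,\ldots,n\}$. It contains a $k$-ordering $H$ (in a given color) if it has a subgraph isomorphic to $H$, all of whose edges have that color, such that for every $i$ the $i$-th smallest vertex of the copy corresponds to a vertex of $H$ that has order-label $i$ or no order-label. $R_<(H)$ is the least $n$ such that every ordered 2-coloring on $n$ vertices contains a monochromatic (red or blue) copy of $H$. *)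

theory Defs
  imports "HOL-Library.Extended_Nat"
begin

record 'a graph =
  verts :: "'a set"
  edges :: "'a set set"

definition simple_graph :: "'a graph \<Rightarrow> bool" where
  "simple_graph H \<longleftrightarrow> finite (verts H) \<and> edges H \<subseteq> {e. e \<subseteq> verts H \<and> card e = 2}"

text \<open>An ordering of \<open>H\<close> is a partial map from vertices to order-labels, undefined at the
  unlabeled vertices.\<close>

definition k_ordering :: "nat \<Rightarrow> 'a graph \<Rightarrow> ('a \<rightharpoonup> nat) \<Rightarrow> bool" where
  "k_ordering k H lab \<longleftrightarrow>
     dom lab \<subseteq> verts H \<and> card (dom lab) = k \<and> inj_on lab (dom lab) \<and>
     ran lab \<subseteq> {1..card (verts H)}"

definition single_ordering :: "'a \<Rightarrow> nat \<Rightarrow> ('a \<rightharpoonup> nat)" where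
  "single_ordering v l = [v \<mapsto> l]"

datatype color = Red | Blue

text \<open>An ordered 2-coloring on \<open>n\<close> vertices is represented by a function
  \<open>c :: nat set \<Rightarrow> color\<close>, of which only the values on the two-element subsets of \<open>{1..n}\<close>
  matter. The list \<open>sorted_list_of_set\<close> is indexed from 0, so the \<open>i\<close>-th smallest vertex of
  the copy sits at position \<open>i - 1\<close>.\<close>

definition contains_ordering ::
    "nat \<Rightarrow> (nat set \<Rightarrow> color) \<Rightarrow> color \<Rightarrow> 'a graph \<Rightarrow> ('a \<rightharpoonup> nat) \<Rightarrow> bool" where
  "contains_ordering n c col H lab \<longleftrightarrow>
     (\<exists>f. inj_on f (verts H) \<and> f ` verts H \<subseteq> {1..n} \<and>
          (\<forall>e\<in>edges H. c (f ` e) = col) \<and>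
          (\<forall>i\<in>{1..card (verts H)}. \<forall>v\<in>verts H.
             f v = sorted_list_of_set (f ` verts H) ! (i - 1) \<longrightarrow>
             lab v = Some i \<or> lab v = None))"

text \<open>The value is an extended natural number, so that it is \<open>\<infinity>\<close>, rather than an unspecified
  number, if no \<open>n\<close> has the required property.\<close>

definition ordered_ramsey :: "'a graph \<Rightarrow> ('a \<rightharpoonup> nat) \<Rightarrow> enat" where
  "ordered_ramsey H lab =
     Inf (enat ` {n. \<forall>c. \<exists>col. contains_ordering n c col H lab})"

datatype pan_vertex = e1 | e2 | e3 | e4

definition three_pan :: "pan_vertex graph" where
  "three_pan = \<lparr> verts = {e1, e2, e3, e4},
                 edges = {{e1, e2}, {e2, e3}, {e2, e4}, {e3, e4}} \<rparr>"

lemma simple_graph_three_pan: "simple_graph three_pan"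
  by (simp add: simple_graph_def three_pan_def)

lemma k_ordering_single_ordering:
  assumes "v \<in> verts H" "1 \<le> l" "l \<le> card (verts H)"
  shows "k_ordering 1 H (single_ordering v l)"
  using assms by (simp add: k_ordering_def single_ordering_def)

end

theory Submission
  imports Defs
begin

text \<open>
  Suppose a colouring of \<open>{1..10}\<close> has no monochromatic copy. If \<open>v\<close> has a smaller neighbour \<open>a\<close>
  in colour \<open>k\<close> and at least two larger neighbours in colour \<open>k\<close>, then \<open>a\<close> and these larger
  neighbours form a clique in the other colour; as every monochromatic \<open>K\<^sub>4\<close> contains the ordered
  pan, \<open>v\<close> has at most two larger neighbours in colour \<open>k\<close>. Hence a vertex joined to smaller ones
  in both colours has at most four larger vertices, so each \<open>v \<le> 5\<close> is joined to all smaller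
  vertices in one colour, its back colour. If \<open>v < w \<le> 5\<close> share the back colour \<open>k\<close>, then \<open>w\<close> is
  the only larger \<open>k\<close>-neighbour of \<open>v\<close>. So no three of \<open>2, 3, 4, 5\<close> share a back colour, and both
  colours occur twice. This yields, for each colour, a vertex below \<open>6\<close> that is joined to all of
  \<open>6, \<dots>, 10\<close> in that colour. Two of the edges from \<open>6\<close> to \<open>7, 8, 9\<close> have the same colour, and they
  form the ordered pan together with the vertex belonging to that colour.
\<close>

lemma color_neq_trans: "x \<noteq> y \<Longrightarrow> y \<noteq> z \<Longrightarrow> x = z" for x y z :: color
  by (cases x; cases y; cases z) auto

text \<open>The label only forces the vertex \<open>e2\<close> of degree 3 to be the second
  smallest. Any of its three neighbours may be the pendant one, so \<open>p\<close>,
  \<open>q\<close>, \<open>r\<close> is an arbitrary arrangement of \<open>a\<close>,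
  \<open>b\<close>, \<open>d\<close>.\<close>

lemma contains_pan:
  fixes a v b d p q r :: nat
  assumes "1 \<le> a" "a < v" "v < b" "b < d" "d \<le> n"
    and pqr: "{p, q, r} = {a, b, d}"
    and col: "c {p, v} = k" "c {v, q} = k" "c {v, r} = k" "c {q, r} = k"
  shows "contains_ordering n c k three_pan (single_ordering e2 2)"
proof -
  define f where "f = case_pan_vertex p v q r"
  have f[simp]: "f e1 = p" "f e2 = v" "f e3 = q" "f e4 = r"
    by (simp_all add: f_def)
  have "card {p, q, r} = 3"
    using assms(2-4) unfolding pqr by simp
  then have dist: "p \<noteq> q" "p \<noteq> r" "q \<noteq> r"
    by (auto simp: card_insert_if split: if_splits)
  have "v \<notin> {p, q, r}"
    using assms(2-4) unfolding pqr by simp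
  then have vne: "v \<noteq> p" "v \<noteq> q" "v \<noteq> r"
    by auto
  have img: "f ` verts three_pan = {a, v, b, d}"
    using pqr by (auto simp: three_pan_def)
  have "sorted_list_of_set (set [a, v, b, d]) = [a, v, b, d]"
    using assms(2-4) by (intro sorted_list_of_set.idem_if_sorted_distinct) auto
  then have srt: "sorted_list_of_set (f ` verts three_pan) = [a, v, b, d]"
    unfolding img by simp
  have card4: "card (verts three_pan) = 4"
    by (simp add: three_pan_def)
  have lab: "single_ordering e2 2 u = Some i \<or> single_ordering e2 2 u = None"
    if "i \<in> {1..4}" "f u = [a, v, b, d] ! (i - 1)" for i u
  proof (cases "u = e2")
    case True
    have "i = 1 \<or> i = 2 \<or> i = 3 \<or> i = 4"
      using that(1) by auto
    then show ?thesis
      using that(2) True assms(2-4) by (auto simp: single_ordering_def)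
  qed (simp add: single_ordering_def)
  have inj: "inj_on f (verts three_pan)"
    using dist vne by (auto simp: three_pan_def)
  have sub: "f ` verts three_pan \<subseteq> {1..n}"
    using assms(1-5) unfolding img by auto
  have mono: "\<forall>e\<in>edges three_pan. c (f ` e) = k"
    using col by (simp add: three_pan_def)
  show ?thesis
    unfolding contains_ordering_def
  proof (intro exI[of _ f] conjI ballI impI)
    show "single_ordering e2 2 u = Some i \<or> single_ordering e2 2 u = None"
      if "i \<in> {1..card (verts three_pan)}"
        "f u = sorted_list_of_set (f ` verts three_pan) ! (i - 1)" for i u
      using lab that unfolding srt card4 .
  qed (use inj sub mono in blast)+
qed

definition pan_free :: "nat \<Rightarrow> (nat set \<Rightarrow> color) \<Rightarrow> bool" where
  "pan_free n c \<longleftrightarrow> (\<forall>k. \<not> contains_ordering n c k three_pan (single_ordering e2 2))"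

text \<open>A third edge of colour \<open>k\<close> would close a triangle at \<open>v\<close>, with
  the remaining neighbour pendant. As \<open>b\<close> and \<open>d\<close> may come in either
  order, exchanging them covers the edge from \<open>a\<close> to \<open>d\<close> too.\<close>

lemma pan_freeD:
  assumes free: "pan_free n c" and "1 \<le> a" "a < v" "v < b" "v < d" "b \<noteq> d" "b \<le> n" "d \<le> n"
    and col: "c {a, v} = k" "c {v, b} = k" "c {v, d} = k"
  shows "c {a, b} \<noteq> k" and "c {b, d} \<noteq> k"
proof -
  have no_pan: "\<not> (c {p, v} = k \<and> c {v, q} = k \<and> c {v, r} = k \<and> c {q, r} = k)"
    if "{p, q, r} = {a, b, d}" for p q r
  proof (cases "b < d")
    case True
    then show ?thesis
      using contains_pan[of a v b d n p q r c k] that assms by (auto simp: pan_free_def)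
  next
    case False
    moreover have "{p, q, r} = {a, d, b}"
      using that by auto
    ultimately show ?thesis
      using contains_pan[of a v d b n p q r c k] assms by (auto simp: pan_free_def)
  qed
  show "c {a, b} \<noteq> k"
    using no_pan[of d a b] col by (auto simp: insert_commute)
  show "c {b, d} \<noteq> k"
    using no_pan[of a b d] col by auto
qed

lemma pan_free_no_K4:
  assumes "pan_free n c" "1 \<le> a" "a < v" "v < b" "v < d" "b \<noteq> d" "b \<le> n" "d \<le> n"
    and "c {a, v} = k" "c {a, b} = k" "c {v, b} = k" "c {v, d} = k"
  shows False
  using pan_freeD(1)[OF assms(1-9,11,12)] assms(10) by simp

lemma card_forward_le_2:
  assumes free: "pan_free n c" and "1 \<le> a" "a < v" and cav: "c {a, v} = k"
  shows "card {w \<in> {v<..n}. c {v, w} = k} \<le> 2" (is "card ?W \<le> 2")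
proof (rule ccontr)
  assume "\<not> card ?W \<le> 2"
  then have "3 \<le> card ?W" by simp
  \<comment> \<open>Taking the minimum makes \<open>x\<close> the second smallest of
    \<open>a\<close>, \<open>x\<close>, \<open>y\<close>, \<open>z\<close>, whichever of
    \<open>y\<close> and \<open>z\<close> is smaller.\<close>
  define x where "x = Min ?W"
  have "?W \<noteq> {}" using \<open>3 \<le> card ?W\<close> by (metis card.empty not_numeral_le_zero)
  then have x: "x \<in> ?W"
    unfolding x_def by (intro Min_in) auto
  have "2 \<le> card (?W - {x})"
    using x \<open>3 \<le> card ?W\<close> by simp
  then obtain y z where yz: "y \<in> ?W - {x}" "z \<in> ?W - {x}" "y \<noteq> z"
    by (meson card_2_iff' obtain_subset_with_card_n subsetD)
  then have less: "x < y" "x < z"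
    using Min_le[of ?W y, folded x_def] Min_le[of ?W z, folded x_def] by simp_all
  have cols: "c {v, x} = k" "c {v, y} = k" "c {v, z} = k" "v < x" "v < y" "v < z" "x \<le> n" "y \<le> n" "z \<le> n"
    using x yz by auto
  note no_pan = pan_freeD[OF free \<open>1 \<le> a\<close> \<open>a < v\<close> _ _ _ _ _ cav]
  have ax: "c {a, x} \<noteq> k"
    using no_pan(1)[of x y] cols less by simp
  have ay: "c {a, y} \<noteq> k"
    using no_pan(1)[of y x] cols less by simp
  have xy: "c {x, y} \<noteq> k"
    using no_pan(2)[of x y] cols less by simp
  have xz: "c {x, z} \<noteq> k"
    using no_pan(2)[of x z] cols less by simp
  show False
  proof (rule pan_free_no_K4[OF free])
    show "1 \<le> a" "a < x" "x < y" "x < z" "y \<noteq> z" "y \<le> n" "z \<le> n"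
      using \<open>1 \<le> a\<close> \<open>a < v\<close> yz(3) cols less by simp_all
    show "c {a, x} = c {a, x}" ..
    show "c {a, y} = c {a, x}" "c {x, y} = c {a, x}" "c {x, z} = c {a, x}"
      using color_neq_trans[OF ay ax[symmetric]] color_neq_trans[OF xy ax[symmetric]]
        color_neq_trans[OF xz ax[symmetric]] .
  qed
qed

lemma back_color_unique:
  assumes free: "pan_free n c" and "v + 5 \<le> n" "1 \<le> a" "a < v" "1 \<le> b" "b < v"
  shows "c {a, v} = c {b, v}"
proof (rule ccontr)
  assume ne: "c {a, v} \<noteq> c {b, v}"
  let ?W = "\<lambda>k. {w \<in> {v<..n}. c {v, w} = k}"
  have "c {v, w} = c {a, v} \<or> c {v, w} = c {b, v}" for w
    using color_neq_trans[OF _ ne, of "c {v, w}"] by blast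
  then have "{v<..n} \<subseteq> ?W (c {a, v}) \<union> ?W (c {b, v})"
    by blast
  then have "card {v<..n} \<le> card (?W (c {a, v}) \<union> ?W (c {b, v}))"
    by (intro card_mono) auto
  also have "\<dots> \<le> card (?W (c {a, v})) + card (?W (c {b, v}))"
    by (rule card_Un_le)
  also have "\<dots> \<le> 2 + 2"
    using card_forward_le_2[OF free \<open>1 \<le> a\<close> \<open>a < v\<close> refl] card_forward_le_2[OF free \<open>1 \<le> b\<close> \<open>b < v\<close> refl]
    by (rule add_mono)
  finally show False
    using assms(2) by simp
qed

lemma not_pan_free_10: "\<not> pan_free 10 c"
proof
  assume free: "pan_free 10 c"
  \<comment> \<open>Vertex 1 lies below every \<open>v \<ge> 2\<close>, so its edge to
    \<open>v\<close> names the back colour. At \<open>v = 1\<close> this is no edge, hence the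
    bounds \<open>2 \<le> v\<close> below.\<close>
  define bc where "bc v = c {1, v}" for v
  have bc: "c {u, v} = bc v" if "1 \<le> u" "u < v" "v \<le> 5" for u v
    unfolding bc_def using back_color_unique[OF free, of v u 1] that by simp
  \<comment> \<open>Otherwise \<open>1\<close>, \<open>v\<close>, \<open>w\<close> is a triangle
    with \<open>x\<close> pendant at \<open>v\<close>.\<close>
  have only: "c {v, x} \<noteq> bc v"
    if "2 \<le> v" "v < w" "w \<le> 5" "bc v = bc w" "v < x" "x \<le> 10" "x \<noteq> w" for v w x
  proof
    assume "c {v, x} = bc v"
    moreover have "c {1, v} = bc v" "c {v, w} = bc v" "c {1, w} = bc v"
      using bc[of 1 v] bc[of v w] bc[of 1 w] that by simp_all
    ultimately show False
      using pan_freeD(1)[OF free, of 1 v w x "bc v"] that by simp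
  qed
  have no3: "\<not> (bc v = k \<and> bc w = k \<and> bc x = k)" if "2 \<le> v" "v < w" "w < x" "x \<le> 5" for k v w x
  proof
    assume *: "bc v = k \<and> bc w = k \<and> bc x = k"
    have "c {v, x} \<noteq> bc v"
      by (rule only[of v w]) (use * that in simp_all)
    moreover have "c {v, x} = bc x"
      by (rule bc) (use that in simp_all)
    ultimately show False
      using * by simp
  qed
  have joined: "\<exists>v<6. 1 \<le> v \<and> (\<forall>x\<in>{6..10}. c {v, x} = k)" for k
  proof -
    \<comment> \<open>If at most one of 2, 3, 4, 5 had a back colour other than \<open>k\<close>,
      three of them would share \<open>k\<close>, against \<open>no3\<close>.\<close>
    have "\<exists>v w. 2 \<le> v \<and> v < w \<and> w \<le> 5 \<and> bc v = bc w \<and> bc v \<noteq> k"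
    proof (rule ccontr)
      assume "\<nexists>v w. 2 \<le> v \<and> v < w \<and> w \<le> 5 \<and> bc v = bc w \<and> bc v \<noteq> k"
      then have *: "bc v = k \<or> bc w = k" if "2 \<le> v" "v < w" "w \<le> 5" for v w
        using that color_neq_trans[of "bc v" k "bc w"] by blast
      have "bc 2 = k \<or> bc 3 = k" "bc 2 = k \<or> bc 4 = k" "bc 2 = k \<or> bc 5 = k"
        "bc 3 = k \<or> bc 4 = k" "bc 3 = k \<or> bc 5 = k" "bc 4 = k \<or> bc 5 = k"
        by (rule *; simp)+
      moreover have "\<not> (bc 2 = k \<and> bc 3 = k \<and> bc 4 = k)" "\<not> (bc 2 = k \<and> bc 3 = k \<and> bc 5 = k)"
        "\<not> (bc 2 = k \<and> bc 4 = k \<and> bc 5 = k)" "\<not> (bc 3 = k \<and> bc 4 = k \<and> bc 5 = k)"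
        by (rule no3; simp)+
      ultimately show False
        by argo
    qed
    then obtain v w where vw: "2 \<le> v" "v < w" "w \<le> 5" "bc v = bc w" "bc v \<noteq> k"
      by blast
    have "c {v, x} = k" if "x \<in> {6..10}" for x
    proof (rule color_neq_trans[OF _ vw(5)])
      show "c {v, x} \<noteq> bc v"
        by (rule only[OF vw(1-4)]) (use vw that in simp_all)
    qed
    then show ?thesis
      using vw by (intro exI[of _ v]) auto
  qed
  have "c {6, 7} = c {6, 8} \<or> c {6, 7} = c {6, 9} \<or> c {6, 8} = c {6, 9}"
    using color_neq_trans[of "c {6, 7}" "c {6, 8}" "c {6, 9}"] by blast
  then obtain b d where bd: "b \<in> {7, 8, 9}" "d \<in> {7, 8, 9}" "b \<noteq> d" "c {6, b} = c {6, d}"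
    using that[of 7 8] that[of 7 9] that[of 8 9] by auto
  obtain v where "v < 6" "1 \<le> v" and v: "\<And>x. x \<in> {6..10} \<Longrightarrow> c {v, x} = c {6, b}"
    using joined[of "c {6, b}"] by auto
  have "b \<in> {6..10}" "b \<le> 10" "d \<le> 10" "6 < b" "6 < d"
    using bd by auto
  \<comment> \<open>Here 6 plays \<open>e2\<close>: the triangle would be \<open>v\<close>, 6,
    \<open>b\<close>, with \<open>d\<close> pendant.\<close>
  then have "c {v, b} \<noteq> c {6, b}"
    using pan_freeD(1)[OF free \<open>1 \<le> v\<close> \<open>v < 6\<close>, of b d] v[of 6] bd(3,4) by simp
  then show False
    using v[OF \<open>b \<in> {6..10}\<close>] by contradiction
qed

theorem theorem3p13:
  shows "ordered_ramsey three_pan (single_ordering e2 2) \<le> 10"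
proof -
  have "(10 :: enat) = enat 10"
    by (simp add: numeral_eq_enat)
  also have "enat 10 \<in> enat ` {n. \<forall>c. \<exists>col. contains_ordering n c col three_pan (single_ordering e2 2)}"
    using not_pan_free_10 by (auto simp: pan_free_def)
  finally show ?thesis
    unfolding ordered_ramsey_def by (rule Inf_lower)
qed

end
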